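(* Let $\ell_0:\mathbb{R}^d\to\mathbb{R}$ be twice continuously differentiable and let $O\in\mathbb{R}^{d\times k}$ satisfy $O^TO=I_k$. Suppose $\ell_0$ has the $O$-mirror symmetry, i.e. $\ell_0(w)=\ell_0((I-2OO^T)w)$ for all $w\in\mathbb{R}^d$. For $\gamma\ge 0$ let $\ell_\gamma(w)=\ell_0(w)+\gamma\|w\|^2$. Then: 1. For any $\gamma$, if $O^Tw=0$ then $O^T\nabla_w\ell_\gamma(w)=0$. 2. If $OO^Tw=0$, then the Hessian $\nabla_w^2\ell_0(w)$ maps $\ker(O^T)$ into $\ker(O^T)$ and $\operatorname{im}(OO^T)=\ker(O^T)^\perp$ into itself; consequently there is an orthonormal basis of eigenvectors of $\nabla_w^2\ell_0(w)$ a subset of which spans $\ker(O^T)$ and the rest of which spans $\operatorname{im}(OO^T)$. 3. If $O^Tw\neq 0$, there exists $\gamma_0$ such that for all $\gamma>\gamma_0$, $\ell_\gamma((I-OO^T)w)<\ell_\gamma(w)$. 4. Assume in addition that the smallest eigenvalue of $\nabla_w^2\ell_0(w)$ is bounded below by a constant $\lambda_{\min}\in\mathbb{R}$ (possibly negative) uniformly in $w$. Then there exists $\gamma_1$ such that for all $\gamma>\gamma_1$, every minimizer $w$ of $\ell_\gamma$ satisfies $O^Tw=0$.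
   Context: $\ell_0$ plays the role of a per-sample (data-dependent) loss with the data point suppressed; $\gamma$ is the weight decay strength. The matrix $OO^T$ is an orthogonal projection and $I-2OO^T$ is the reflection through the subspace $\ker(O^T)$. *)

theory Defs
  imports "HOL-Analysis.Analysis"
begin

text \<open>Regularised loss: l_gamma(w) = l0(w) + gamma * norm(w)^2.\<close>
definition lgam :: "(real^'d \<Rightarrow> real) \<Rightarrow> real \<Rightarrow> real^'d \<Rightarrow> real" where
  "lgam l0 \<gamma> w = l0 w + \<gamma> * (norm w)^2"

text \<open>Kernel of O^T and image of O O^T (O written Om).\<close>
definition kerOT :: "real^'k^'d \<Rightarrow> (real^'d) set" where
  "kerOT Om = {v. transpose Om *v v = 0}"

definition imOOT :: "real^'k^'d \<Rightarrow> (real^'d) set" where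
  "imOOT Om = range (\<lambda>v. (Om ** transpose Om) *v v)"

end

theory Submission
  imports Defs
begin

(*
  The reflection R = I - 2 O O^T is symmetric and involutive, so differentiating
  l0 = l0 o R gives grad l0 (w) = R grad l0 (R w) and Hess l0 (w) = R Hess l0 (R w) R.
  At a point fixed by R, i.e. with O^T w = 0, the gradient is fixed by R and hence lies in
  ker O^T, while the Hessian commutes with R and therefore with the projection O O^T.
  The Hessian is symmetric (Schwarz), so diagonalising it separately on the two invariant
  subspaces ker O^T and im O O^T yields the split eigenbasis.
  Removing the component p = O O^T w of w lowers the weight-decay term by gamma |p|^2, which
  beats the change of l0 once gamma is large. Finally, on the line t |-> (w - p) + t p the
  regularised loss has second derivative at least (lambda_min + 2 gamma) |p|^2 > 0 and, by
  the mirror symmetry, equal values at t = 1 and t = -1; so the midpoint t = 0 is strictly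
  better than t = 1, and a minimiser w must have p = 0.
*)


section \<open>Matrix identities\<close>

lemma linear_matrix_vector_mult_left: "linear (\<lambda>A::real^'n^'m. A *v v)"
  by (auto simp: linear_iff matrix_vector_mult_def vec_eq_iff sum.distrib algebra_simps sum_distrib_left)

lemma matrix_vector_mult_minus_left: "(- A) *v x = - (A *v (x::'a::ring_1^'n))"
  by (simp add: matrix_vector_mult_def vec_eq_iff sum_negf)

lemma transpose_minus: "transpose (- A) = - transpose (A::'a::ab_group_add^'n^'m)"
  by (simp add: transpose_def vec_eq_iff)

lemma transpose_diff: "transpose (A - B) = transpose A - transpose (B::'a::ab_group_add^'n^'m)"
  by (simp add: transpose_def vec_eq_iff)

lemma symmetric_matrix_iff:
  fixes A :: "real^'n^'n"
  shows "transpose A = A \<longleftrightarrow> (\<forall>x y. (A *v x) \<bullet> y = x \<bullet> (A *v y))"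
proof -
  have "x \<bullet> (A *v y) = (transpose A *v x) \<bullet> y" for x y
    by (simp add: dot_lmul_matrix)
  then have "(\<forall>x y. (A *v x) \<bullet> y = x \<bullet> (A *v y)) \<longleftrightarrow> (\<forall>x. A *v x = transpose A *v x)"
    by (simp add: vector_eq_rdot)
  then show ?thesis by (auto simp: matrix_eq)
qed

lemma symmetric_matrix_inner:
  fixes A :: "real^'n^'n"
  assumes "transpose A = A"
  shows "(A *v x) \<bullet> y = x \<bullet> (A *v y)"
  using assms symmetric_matrix_iff by blast

lemma inner_matrix_vector_scaleR:
  fixes A :: "real^'n^'n"
  shows "(A *v (c *\<^sub>R x)) \<bullet> (c *\<^sub>R x) = c\<^sup>2 * ((A *v x) \<bullet> x)"
  by (simp add: matrix_vector_mult_scaleR power2_eq_square)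

section \<open>Calculus\<close>

lemma has_real_derivative_along_line:
  fixes f :: "'a::real_inner \<Rightarrow> real"
  assumes grad: "\<And>w. (f has_derivative (\<lambda>h. g w \<bullet> h)) (at w)"
  shows "((\<lambda>t. f (y + t *\<^sub>R u)) has_real_derivative (g (y + t *\<^sub>R u) \<bullet> u)) (at t)"
proof -
  have "((\<lambda>t. y + t *\<^sub>R u) has_derivative (\<lambda>h. h *\<^sub>R u)) (at t)"
    by (auto intro!: derivative_eq_intros)
  from has_derivative_compose[OF this grad]
  show ?thesis
    by (simp add: has_field_derivative_def mult_commute_abs)
qed

lemma has_real_derivative_gradient_along_line:
  fixes g :: "real^'n \<Rightarrow> real^'n"
  assumes hess: "\<And>w. (g has_derivative (\<lambda>h. H w *v h)) (at w)"
  shows "((\<lambda>t. g (y + t *\<^sub>R v) \<bullet> u) has_real_derivative ((H (y + t *\<^sub>R v) *v v) \<bullet> u)) (at t)"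
proof -
  have "((\<lambda>t. y + t *\<^sub>R v) has_derivative (\<lambda>h. h *\<^sub>R v)) (at t)"
    by (auto intro!: derivative_eq_intros)
  from has_derivative_compose[OF this hess]
  have "((\<lambda>t. g (y + t *\<^sub>R v) \<bullet> u) has_derivative (\<lambda>h. (H (y + t *\<^sub>R v) *v (h *\<^sub>R v)) \<bullet> u)) (at t)"
    by (auto intro!: derivative_eq_intros)
  then show ?thesis
    by (simp add: has_field_derivative_def matrix_vector_mult_scaleR mult_commute_abs)
qed

lemma second_difference_mean_value:
  fixes f :: "real^'n \<Rightarrow> real"
  assumes grad: "\<And>w. (f has_derivative (\<lambda>h. g w \<bullet> h)) (at w)"
    and hess: "\<And>w. (g has_derivative (\<lambda>h. H w *v h)) (at w)"
    and t: "t > 0"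
  shows "\<exists>p. norm (p - x) \<le> t * (norm u + norm v) \<and>
    f (x + t *\<^sub>R u + t *\<^sub>R v) - f (x + t *\<^sub>R u) - f (x + t *\<^sub>R v) + f x = t\<^sup>2 * ((H p *v v) \<bullet> u)"
proof -
  define \<phi> where "\<phi> a = f ((x + t *\<^sub>R v) + a *\<^sub>R u) - f (x + a *\<^sub>R u)" for a
  have "(\<phi> has_real_derivative (g ((x + t *\<^sub>R v) + a *\<^sub>R u) \<bullet> u - g (x + a *\<^sub>R u) \<bullet> u)) (at a)" for a
    unfolding \<phi>_def by (intro DERIV_diff has_real_derivative_along_line[OF grad])
  from MVT2[OF t this] obtain \<xi> where \<xi>: "0 < \<xi>" "\<xi> < t"
    "\<phi> t - \<phi> 0 = t * (g ((x + \<xi> *\<^sub>R u) + t *\<^sub>R v) \<bullet> u - g (x + \<xi> *\<^sub>R u) \<bullet> u)"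
    by (auto simp: algebra_simps)
  define \<psi> where "\<psi> b = g ((x + \<xi> *\<^sub>R u) + b *\<^sub>R v) \<bullet> u" for b
  have "(\<psi> has_real_derivative ((H ((x + \<xi> *\<^sub>R u) + b *\<^sub>R v) *v v) \<bullet> u)) (at b)" for b
    unfolding \<psi>_def by (rule has_real_derivative_gradient_along_line[OF hess])
  from MVT2[OF t this] obtain \<eta> where \<eta>: "0 < \<eta>" "\<eta> < t"
    "\<psi> t - \<psi> 0 = t * ((H ((x + \<xi> *\<^sub>R u) + \<eta> *\<^sub>R v) *v v) \<bullet> u)"
    by auto
  define p where "p = (x + \<xi> *\<^sub>R u) + \<eta> *\<^sub>R v"
  have "norm (p - x) \<le> \<xi> * norm u + \<eta> * norm v"
    unfolding p_def using norm_triangle_ineq[of "\<xi> *\<^sub>R u" "\<eta> *\<^sub>R v"] \<xi> \<eta> by simp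
  also have "\<dots> \<le> t * (norm u + norm v)"
    using \<xi> \<eta> by (simp add: distrib_left add_mono mult_right_mono)
  finally have "norm (p - x) \<le> t * (norm u + norm v)" .
  moreover have "f (x + t *\<^sub>R u + t *\<^sub>R v) - f (x + t *\<^sub>R u) - f (x + t *\<^sub>R v) + f x = \<phi> t - \<phi> 0"
    unfolding \<phi>_def by (simp add: algebra_simps)
  moreover have "\<phi> t - \<phi> 0 = t\<^sup>2 * ((H p *v v) \<bullet> u)"
    using \<xi>(3) \<eta>(3) unfolding \<psi>_def p_def by (simp add: power2_eq_square)
  ultimately show ?thesis by auto
qed

lemma hessian_inner_commute:
  fixes f :: "real^'n \<Rightarrow> real"
  assumes grad: "\<And>w. (f has_derivative (\<lambda>h. g w \<bullet> h)) (at w)"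
    and hess: "\<And>w. (g has_derivative (\<lambda>h. H w *v h)) (at w)"
    and hess_cont: "continuous_on UNIV H"
  shows "(H x *v v) \<bullet> u = (H x *v u) \<bullet> v"
proof (rule ccontr)
  define c where "c u v p = (H p *v v) \<bullet> u" for u v p
  have cont: "isCont (c u v) x" for u v
  proof -
    have "isCont H x" using hess_cont by (simp add: continuous_on_eq_continuous_at)
    from linear_continuous_compose[OF this linear_matrix_vector_mult_left]
    show ?thesis unfolding c_def by (intro continuous_intros)
  qed
  assume "(H x *v v) \<bullet> u \<noteq> (H x *v u) \<bullet> v"
  then have e: "\<bar>c u v x - c v u x\<bar> / 2 > 0" (is "?e > 0") unfolding c_def by simp
  obtain d1 where d1: "d1 > 0" "\<And>p. dist p x < d1 \<Longrightarrow> \<bar>c u v p - c u v x\<bar> < ?e"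
    using cont[of u v] e unfolding continuous_at_eps_delta dist_real_def by blast
  obtain d2 where d2: "d2 > 0" "\<And>p. dist p x < d2 \<Longrightarrow> \<bar>c v u p - c v u x\<bar> < ?e"
    using cont[of v u] e unfolding continuous_at_eps_delta dist_real_def by blast
  define N where "N = norm u + norm v + 1"
  have N: "N > 0" unfolding N_def by (simp add: add_nonneg_pos)
  define t where "t = min d1 d2 / (2 * N)"
  have t: "t > 0" using d1(1) d2(1) N unfolding t_def by simp
  have "t * (norm u + norm v) < t * N" using t unfolding N_def by simp
  also have "\<dots> < min d1 d2" using d1(1) d2(1) N unfolding t_def by (simp add: min_def)
  finally have "t * (norm u + norm v) < min d1 d2" .
  then have near: "dist p x < d1" "dist q x < d2"
    if "norm (p - x) \<le> t * (norm u + norm v)" "norm (q - x) \<le> t * (norm v + norm u)" for p q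
    using that by (auto simp: dist_norm add.commute)
  obtain p where p: "norm (p - x) \<le> t * (norm u + norm v)"
    "f (x + t *\<^sub>R u + t *\<^sub>R v) - f (x + t *\<^sub>R u) - f (x + t *\<^sub>R v) + f x = t\<^sup>2 * c u v p"
    using second_difference_mean_value[OF grad hess t] unfolding c_def by blast
  obtain q where q: "norm (q - x) \<le> t * (norm v + norm u)"
    "f (x + t *\<^sub>R v + t *\<^sub>R u) - f (x + t *\<^sub>R v) - f (x + t *\<^sub>R u) + f x = t\<^sup>2 * c v u q"
    using second_difference_mean_value[OF grad hess t] unfolding c_def by blast
  \<comment> \<open>The second difference is symmetric in u and v, so both mean values coincide.\<close>
  have "c u v p = c v u q" using p(2) q(2) t by (simp add: algebra_simps)
  moreover have "\<bar>c u v p - c u v x\<bar> < ?e" "\<bar>c v u q - c v u x\<bar> < ?e"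
    using d1(2) d2(2) near[OF p(1) q(1)] by auto
  ultimately show False by (simp add: abs_less_iff abs_if split: if_splits)
qed

lemma hessian_symmetric:
  fixes f :: "real^'n \<Rightarrow> real"
  assumes "\<And>w. (f has_derivative (\<lambda>h. g w \<bullet> h)) (at w)"
    and "\<And>w. (g has_derivative (\<lambda>h. H w *v h)) (at w)"
    and "continuous_on UNIV H"
  shows "transpose (H x) = H x"
  unfolding symmetric_matrix_iff
  using hessian_inner_commute[OF assms] by (metis inner_commute)

lemma strict_midpoint_convex_if_second_derivative_pos:
  fixes k :: "real \<Rightarrow> real"
  assumes k': "\<And>t. (k has_real_derivative k' t) (at t)"
    and k'': "\<And>t. (k' has_real_derivative k'' t) (at t)"
    and pos: "\<And>t. k'' t > 0"
    and "a < b"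
  shows "2 * k ((a + b) / 2) < k a + k b"
proof -
  define m where "m = (a + b) / 2"
  have "a < m" "m < b" unfolding m_def using \<open>a < b\<close> by simp_all
  obtain \<xi>1 where \<xi>1: "a < \<xi>1" "\<xi>1 < m" "k m - k a = (m - a) * k' \<xi>1"
    using MVT2[OF \<open>a < m\<close> k'] by blast
  obtain \<xi>2 where \<xi>2: "m < \<xi>2" "\<xi>2 < b" "k b - k m = (b - m) * k' \<xi>2"
    using MVT2[OF \<open>m < b\<close> k'] by blast
  have "\<xi>1 < \<xi>2" using \<xi>1 \<xi>2 by simp
  then obtain \<zeta> where "k' \<xi>2 - k' \<xi>1 = (\<xi>2 - \<xi>1) * k'' \<zeta>"
    using MVT2[OF \<open>\<xi>1 < \<xi>2\<close> k''] by blast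
  with \<open>\<xi>1 < \<xi>2\<close> pos[of \<zeta>] have "k' \<xi>1 < k' \<xi>2"
    by (metis diff_gt_0_iff_gt mult_pos_pos)
  moreover have "b - m = m - a" unfolding m_def by (simp add: field_simps)
  ultimately have "k m - k a < k b - k m"
    using \<xi>1(3) \<xi>2(3) \<open>a < m\<close> by simp
  then show ?thesis unfolding m_def by simp
qed

lemma gradient_of_invariant_function:
  fixes f :: "real^'n \<Rightarrow> real" and R :: "real^'n^'n"
  assumes grad: "\<And>w. (f has_derivative (\<lambda>h. g w \<bullet> h)) (at w)"
    and invariant: "\<And>w. f (R *v w) = f w"
  shows "g w = transpose R *v g (R *v w)"
proof -
  have "((\<lambda>w. f (R *v w)) has_derivative (\<lambda>h. g (R *v w) \<bullet> (R *v h))) (at w)"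
    by (rule has_derivative_compose[OF bounded_linear_imp_has_derivative grad]) simp
  then have "(f has_derivative (\<lambda>h. (transpose R *v g (R *v w)) \<bullet> h)) (at w)"
    by (simp add: invariant dot_lmul_matrix)
  from has_derivative_unique[OF grad this] show ?thesis
    by (metis vector_eq_rdot)
qed

lemma hessian_of_invariant_gradient:
  fixes g :: "real^'n \<Rightarrow> real^'n" and R :: "real^'n^'n"
  assumes hess: "\<And>w. (g has_derivative (\<lambda>h. H w *v h)) (at w)"
    and invariant: "\<And>w. transpose R *v g (R *v w) = g w"
  shows "H w *v h = transpose R *v (H (R *v w) *v (R *v h))"
proof -
  have "((\<lambda>w. g (R *v w)) has_derivative (\<lambda>h. H (R *v w) *v (R *v h))) (at w)"
    by (rule has_derivative_compose[OF bounded_linear_imp_has_derivative hess]) simp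
  then have "((\<lambda>w. transpose R *v g (R *v w)) has_derivative
      (\<lambda>h. transpose R *v (H (R *v w) *v (R *v h)))) (at w)"
    by (rule has_derivative_compose[OF _ bounded_linear_imp_has_derivative])
      (rule matrix_vector_mul_bounded_linear)
  moreover have "(\<lambda>w. transpose R *v g (R *v w)) = g"
    by (rule ext) (rule invariant)
  ultimately have "(g has_derivative (\<lambda>h. transpose R *v (H (R *v w) *v (R *v h)))) (at w)"
    by (simp only:)
  from has_derivative_unique[OF hess this] show ?thesis by metis
qed

lemma lgam_has_derivative:
  fixes l0 :: "real^'n \<Rightarrow> real"
  assumes "(l0 has_derivative (\<lambda>h. g w \<bullet> h)) (at w)"
  shows "(lgam l0 \<gamma> has_derivative (\<lambda>h. (g w + (2 * \<gamma>) *\<^sub>R w) \<bullet> h)) (at w)"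
proof -
  have "lgam l0 \<gamma> = (\<lambda>x. l0 x + \<gamma> * (x \<bullet> x))"
    by (simp add: fun_eq_iff lgam_def power2_norm_eq_inner)
  moreover have "((\<lambda>x. x \<bullet> x) has_derivative (\<lambda>h. w \<bullet> h + h \<bullet> w)) (at w)"
    by (rule has_derivative_inner[OF has_derivative_ident has_derivative_ident])
  then have "((\<lambda>x. l0 x + \<gamma> * (x \<bullet> x)) has_derivative
      (\<lambda>h. g w \<bullet> h + \<gamma> * (w \<bullet> h + h \<bullet> w))) (at w)"
    by (intro derivative_intros assms)
  ultimately show ?thesis
    by (simp add: inner_add_left inner_commute algebra_simps)
qed

section \<open>Eigenvectors of symmetric matrices\<close>

lemma linear_le_quadratic_imp_zero:
  fixes a C :: real
  assumes "\<And>s. 2 * s * a \<le> s\<^sup>2 * C"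
  shows "a = 0"
proof (rule ccontr)
  assume "a \<noteq> 0"
  define k where "k = \<bar>C\<bar> + 1"
  have k: "k > 0" unfolding k_def by simp
  have "(2 * (a / k) * a) * k\<^sup>2 \<le> ((a / k)\<^sup>2 * C) * k\<^sup>2"
    using assms[of "a / k"] by (intro mult_right_mono) auto
  then have "2 * k * a\<^sup>2 \<le> C * a\<^sup>2"
    using k by (simp add: power2_eq_square field_simps)
  with \<open>a \<noteq> 0\<close> have "2 * k \<le> C" by simp
  then show False unfolding k_def by simp
qed

lemma rayleigh_max_imp_eigenvector:
  fixes A :: "real^'n^'n"
  assumes sym: "transpose A = A" and S: "subspace S" and inv: "\<And>x. x \<in> S \<Longrightarrow> A *v x \<in> S"
    and x0: "x0 \<in> S" "norm x0 = 1"
    and max: "\<And>x. x \<in> S \<Longrightarrow> norm x = 1 \<Longrightarrow> (A *v x) \<bullet> x \<le> (A *v x0) \<bullet> x0"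
  shows "A *v x0 = ((A *v x0) \<bullet> x0) *\<^sub>R x0"
proof -
  define \<mu> where "\<mu> = (A *v x0) \<bullet> x0"
  have xx: "x0 \<bullet> x0 = 1" using x0(2) by (simp add: dot_square_norm)
  \<comment> \<open>First variation of the Rayleigh quotient along x0 + s y for y \<bottom> x0.\<close>
  have orth: "(A *v x0) \<bullet> y = 0" if y: "y \<in> S" "y \<bullet> x0 = 0" for y
  proof (rule linear_le_quadratic_imp_zero)
    fix s :: real
    define z where "z = x0 + s *\<^sub>R y"
    have zS: "z \<in> S" unfolding z_def using S x0 y by (simp add: subspace_add subspace_mul)
    have nz: "(norm z)\<^sup>2 = 1 + s\<^sup>2 * (y \<bullet> y)"
      unfolding z_def power2_norm_eq_inner using xx y(2)
      by (simp add: inner_add_left inner_add_right inner_commute power2_eq_square)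
    have "z \<bullet> x0 = 1" unfolding z_def using xx y(2) by (simp add: inner_add_left)
    then have "norm z > 0" by auto
    then have "(A *v ((1 / norm z) *\<^sub>R z)) \<bullet> ((1 / norm z) *\<^sub>R z) \<le> \<mu>"
      unfolding \<mu>_def using zS S by (intro max) (auto simp: subspace_mul)
    then have "(A *v z) \<bullet> z \<le> \<mu> * (norm z)\<^sup>2"
      using \<open>norm z > 0\<close> unfolding inner_matrix_vector_scaleR by (simp add: field_simps)
    moreover have "(A *v z) \<bullet> z = \<mu> + 2 * s * ((A *v x0) \<bullet> y) + s\<^sup>2 * ((A *v y) \<bullet> y)"
      using symmetric_matrix_inner[OF sym, of y x0] unfolding z_def \<mu>_def
      by (simp add: matrix_vector_right_distrib matrix_vector_mult_scaleR inner_add_left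
          inner_add_right inner_commute power2_eq_square algebra_simps)
    ultimately show "2 * s * ((A *v x0) \<bullet> y) \<le> s\<^sup>2 * (\<mu> * (y \<bullet> y) - (A *v y) \<bullet> y)"
      using nz by (simp add: algebra_simps)
  qed
  define z where "z = A *v x0 - \<mu> *\<^sub>R x0"
  have "z \<in> S" unfolding z_def using S x0 inv by (simp add: subspace_diff subspace_mul)
  moreover have "z \<bullet> x0 = 0" unfolding z_def \<mu>_def using xx by (simp add: inner_diff_left)
  ultimately have "(A *v x0) \<bullet> z = 0" "x0 \<bullet> z = 0"
    using orth by (simp_all add: inner_commute)
  then have "z \<bullet> z = 0" unfolding z_def by (simp add: inner_diff_left)
  then show ?thesis unfolding z_def \<mu>_def by simp
qed

lemma eigenvector_in_invariant_subspace:
  fixes A :: "real^'n^'n"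
  assumes sym: "transpose A = A" and S: "subspace S" and inv: "\<And>x. x \<in> S \<Longrightarrow> A *v x \<in> S"
    and "S \<noteq> {0}"
  obtains x0 where "x0 \<in> S" "norm x0 = 1" "A *v x0 = ((A *v x0) \<bullet> x0) *\<^sub>R x0"
proof -
  define K where "K = S \<inter> sphere 0 1"
  have "compact K" unfolding K_def by (intro closed_Int_compact closed_subspace S compact_sphere)
  obtain x where "x \<in> S" "x \<noteq> 0" using \<open>S \<noteq> {0}\<close> S subspace_0 by blast
  then have "(1 / norm x) *\<^sub>R x \<in> K" unfolding K_def using S by (simp add: subspace_mul)
  then have "K \<noteq> {}" by blast
  have "continuous_on K (\<lambda>x. (A *v x) \<bullet> x)"
    by (intro continuous_intros)
  from continuous_attains_sup[OF \<open>compact K\<close> \<open>K \<noteq> {}\<close> this]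
  obtain x0 where "x0 \<in> K" "\<And>y. y \<in> K \<Longrightarrow> (A *v y) \<bullet> y \<le> (A *v x0) \<bullet> x0" by blast
  with rayleigh_max_imp_eigenvector[OF sym S inv] show ?thesis
    by (intro that) (auto simp: K_def)
qed

lemma orthonormal_eigenbasis_of_invariant_subspace:
  fixes A :: "real^'n^'n"
  assumes sym: "transpose A = A"
  shows "subspace S \<Longrightarrow> (\<And>x. x \<in> S \<Longrightarrow> A *v x \<in> S) \<Longrightarrow>
    \<exists>B. B \<subseteq> S \<and> pairwise orthogonal B \<and> (\<forall>b\<in>B. norm b = 1) \<and> span B = S
        \<and> (\<forall>b\<in>B. \<exists>\<mu>. A *v b = \<mu> *\<^sub>R b)"
proof (induction "dim S" arbitrary: S rule: less_induct)
  case less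
  show ?case
  proof (cases "S = {0}")
    case True
    then show ?thesis by (intro exI[of _ "{}"]) auto
  next
    case False
    obtain x0 where x0: "x0 \<in> S" "norm x0 = 1" "A *v x0 = ((A *v x0) \<bullet> x0) *\<^sub>R x0"
      using eigenvector_in_invariant_subspace[OF sym less.prems False] by blast
    have xx: "x0 \<bullet> x0 = 1" using x0(2) by (simp add: dot_square_norm)
    define S' where "S' = {y\<in>S. y \<bullet> x0 = 0}"
    have "subspace S'"
      using less.prems(1) unfolding S'_def subspace_def by (auto simp: inner_add_left)
    moreover have "A *v y \<in> S'" if "y \<in> S'" for y
    proof -
      have "(A *v y) \<bullet> x0 = ((A *v x0) \<bullet> x0) * (y \<bullet> x0)"
        by (subst symmetric_matrix_inner[OF sym], subst x0(3)) simp
      then show ?thesis using that less.prems(2) unfolding S'_def by auto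
    qed
    moreover have "dim S' < dim S"
    proof (rule dim_psubset)
      have "S' \<subset> S" unfolding S'_def using x0(1) xx by force
      then show "span S' \<subset> span S"
        using \<open>subspace S'\<close> less.prems(1) by (metis span_eq_iff)
    qed
    ultimately obtain B' where B': "B' \<subseteq> S'" "pairwise orthogonal B'" "\<forall>b\<in>B'. norm b = 1"
        "span B' = S'" "\<forall>b\<in>B'. \<exists>\<mu>. A *v b = \<mu> *\<^sub>R b"
      using less.hyps by blast
    have "S \<subseteq> span (insert x0 B')"
    proof
      fix y assume "y \<in> S"
      then have "y - (y \<bullet> x0) *\<^sub>R x0 \<in> span B'"
        using B'(4) less.prems(1) x0(1) xx
        by (simp add: S'_def inner_diff_left subspace_diff subspace_mul)
      then have "y - (y \<bullet> x0) *\<^sub>R x0 + (y \<bullet> x0) *\<^sub>R x0 \<in> span (insert x0 B')"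
        by (meson span_add span_base span_mono span_mul insertI1 subset_insertI subsetD)
      then show "y \<in> span (insert x0 B')" by simp
    qed
    moreover have "insert x0 B' \<subseteq> S" using B'(1) x0(1) unfolding S'_def by auto
    moreover have "pairwise orthogonal (insert x0 B')"
      using B'(1,2) unfolding S'_def
      by (auto simp: pairwise_insert orthogonal_def inner_commute)
    ultimately show ?thesis
      using B'(3,5) x0 less.prems(1)
      by (intro exI[of _ "insert x0 B'"]) (auto simp: span_minimal subset_antisym)
  qed
qed

lemma eigenvalue_lower_bound_imp_quadratic_form_lower_bound:
  fixes A :: "real^'n^'n"
  assumes sym: "transpose A = A"
    and lower: "\<And>v \<mu>. v \<noteq> 0 \<Longrightarrow> A *v v = \<mu> *\<^sub>R v \<Longrightarrow> lmin \<le> \<mu>"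
  shows "lmin * (v \<bullet> v) \<le> (A *v v) \<bullet> v"
proof -
  have "continuous_on (sphere 0 1) (\<lambda>x. (A *v x) \<bullet> x)"
    by (intro continuous_intros)
  moreover have "axis undefined 1 \<in> sphere (0::real^'n) 1" by (simp add: norm_axis_1)
  ultimately obtain x0 :: "real^'n" where "x0 \<in> sphere 0 1"
    and "\<And>y. y \<in> sphere 0 1 \<Longrightarrow> (A *v x0) \<bullet> x0 \<le> (A *v y) \<bullet> y"
    using continuous_attains_inf[OF compact_sphere] by blast
  then have x0: "norm x0 = 1" and min: "\<And>y. norm y = 1 \<Longrightarrow> (A *v x0) \<bullet> x0 \<le> (A *v y) \<bullet> y"
    by auto
  \<comment> \<open>A minimiser of the Rayleigh quotient of A maximises that of -A, hence is an eigenvector.\<close>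
  have "(- A) *v x0 = (((- A) *v x0) \<bullet> x0) *\<^sub>R x0"
    using sym x0 min
    by (intro rayleigh_max_imp_eigenvector[OF _ subspace_UNIV])
      (auto simp: matrix_vector_mult_minus_left transpose_minus)
  then have "lmin \<le> (A *v x0) \<bullet> x0"
    using x0 by (intro lower[of x0]) (auto simp: matrix_vector_mult_minus_left)
  show ?thesis
  proof (cases "v = 0")
    case False
    have "(A *v x0) \<bullet> x0 \<le> (1 / norm v)\<^sup>2 * ((A *v v) \<bullet> v)"
      using min[of "(1 / norm v) *\<^sub>R v"] False unfolding inner_matrix_vector_scaleR by simp
    with \<open>lmin \<le> (A *v x0) \<bullet> x0\<close> have "lmin \<le> (A *v v) \<bullet> v / (norm v)\<^sup>2"
      by (simp add: field_simps)
    with False show ?thesis by (simp add: field_simps power2_norm_eq_inner)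
  qed simp
qed

lemma orthonormal_eigenbasis_split_by_projection:
  fixes A P :: "real^'n^'n"
  assumes A_sym: "transpose A = A" and P_sym: "transpose P = P" and P_idem: "P ** P = P"
    and commute: "A ** P = P ** A"
  shows "\<exists>B B1. pairwise orthogonal B \<and> (\<forall>b\<in>B. norm b = 1) \<and> span B = UNIV
          \<and> (\<forall>b\<in>B. \<exists>\<mu>. A *v b = \<mu> *\<^sub>R b)
          \<and> B1 \<subseteq> B \<and> span B1 = {v. P *v v = 0} \<and> span (B - B1) = range ((*v) P)"
proof -
  have PP: "P *v (P *v x) = P *v x" and AP: "A *v (P *v x) = P *v (A *v x)" for x
    using P_idem commute by (simp_all add: matrix_vector_mul_assoc)
  have "subspace {v. P *v v = 0}"
    by (auto simp: subspace_def matrix_vector_right_distrib matrix_vector_mult_scaleR)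
  moreover have "A *v v \<in> {v. P *v v = 0}" if "v \<in> {v. P *v v = 0}" for v
    using that AP[of v] by simp
  ultimately have "\<exists>B1. B1 \<subseteq> {v. P *v v = 0} \<and> pairwise orthogonal B1 \<and> (\<forall>b\<in>B1. norm b = 1)
      \<and> span B1 = {v. P *v v = 0} \<and> (\<forall>b\<in>B1. \<exists>\<mu>. A *v b = \<mu> *\<^sub>R b)"
    by (rule orthonormal_eigenbasis_of_invariant_subspace[OF A_sym])
  then obtain B1 where B1: "pairwise orthogonal B1" "\<forall>b\<in>B1. norm b = 1"
      "span B1 = {v. P *v v = 0}" "\<forall>b\<in>B1. \<exists>\<mu>. A *v b = \<mu> *\<^sub>R b"
    by blast
  have "subspace (range ((*v) P))"
    by (simp add: linear_subspace_image matrix_vector_mul_linear)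
  moreover have "A *v v \<in> range ((*v) P)" if "v \<in> range ((*v) P)" for v
  proof -
    from that obtain u where "v = P *v u" by blast
    then show ?thesis using AP[of u] by simp
  qed
  ultimately have "\<exists>B2. B2 \<subseteq> range ((*v) P) \<and> pairwise orthogonal B2 \<and> (\<forall>b\<in>B2. norm b = 1)
      \<and> span B2 = range ((*v) P) \<and> (\<forall>b\<in>B2. \<exists>\<mu>. A *v b = \<mu> *\<^sub>R b)"
    by (rule orthonormal_eigenbasis_of_invariant_subspace[OF A_sym])
  then obtain B2 where B2: "pairwise orthogonal B2" "\<forall>b\<in>B2. norm b = 1"
      "span B2 = range ((*v) P)" "\<forall>b\<in>B2. \<exists>\<mu>. A *v b = \<mu> *\<^sub>R b"
    by blast
  have orth12: "b1 \<bullet> b2 = 0" if b1: "b1 \<in> B1" and b2: "b2 \<in> B2" for b1 b2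
  proof -
    from b2 have "b2 \<in> span B2" by (rule span_base)
    then obtain u where u: "b2 = P *v u" using B2(3) by auto
    from b1 have "b1 \<in> span B1" by (rule span_base)
    then have "P *v b1 = 0" using B1(3) by simp
    with u show ?thesis
      using symmetric_matrix_inner[OF P_sym, of b1 u] by simp
  qed
  then have "B1 \<inter> B2 = {}" using B1(2) by fastforce
  then have "B1 \<union> B2 - B1 = B2" by blast
  moreover have "pairwise orthogonal (B1 \<union> B2)"
    using B1(1) B2(1) orth12 unfolding pairwise_def orthogonal_def by (metis UnE inner_commute)
  moreover have "x \<in> span (B1 \<union> B2)" for x
  proof -
    have "x - P *v x \<in> span B1" "P *v x \<in> span B2"
      using B1(3) B2(3) PP[of x] by (auto simp: matrix_vector_mult_diff_distrib)
    then have "(x - P *v x) + P *v x \<in> span (B1 \<union> B2)"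
      by (meson span_add span_mono sup_ge1 sup_ge2 subsetD)
    then show ?thesis by simp
  qed
  ultimately show ?thesis
    using B1 B2 by (intro exI[of _ "B1 \<union> B2"] exI[of _ B1]) auto
qed

section \<open>Orthogonal projections and reflections\<close>

lemma norm_pythagoras_projection:
  fixes P :: "real^'n^'n"
  assumes P_sym: "transpose P = P" and P_idem: "P ** P = P"
  shows "(norm x)\<^sup>2 = (norm (x - P *v x))\<^sup>2 + (norm (P *v x))\<^sup>2"
proof -
  have "(P *v x) \<bullet> (P *v x) = x \<bullet> (P *v x)"
    using symmetric_matrix_inner[OF P_sym, of x "P *v x"] P_idem
    by (simp add: matrix_vector_mul_assoc)
  then have "(x - P *v x) \<bullet> (P *v x) = 0" by (simp add: inner_diff_left)
  then show ?thesis
    using norm_add_Pythagorean[of "x - P *v x" "P *v x"] by (simp add: orthogonal_def)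
qed

lemma reflection_apply: "(mat 1 - 2 *\<^sub>R P) *v x = x - 2 *\<^sub>R (P *v (x::real^'n))"
  by (simp add: matrix_vector_mult_diff_rdistrib scaleR_matrix_vector_assoc[symmetric])

lemma reflection_symmetric:
  fixes P :: "real^'n^'n"
  assumes "transpose P = P"
  shows "transpose (mat 1 - 2 *\<^sub>R P) = mat 1 - 2 *\<^sub>R P"
  using assms by (simp add: transpose_diff transpose_scalar)

lemma reflection_involutive:
  fixes P :: "real^'n^'n"
  assumes P_idem: "P ** P = P"
  shows "(mat 1 - 2 *\<^sub>R P) *v ((mat 1 - 2 *\<^sub>R P) *v x) = x"
proof -
  have "P *v (P *v x) = P *v x" using P_idem by (simp add: matrix_vector_mul_assoc)
  then show ?thesis
    unfolding reflection_apply
    by (simp add: matrix_vector_mult_diff_distrib matrix_vector_mult_scaleR scaleR_right_diff_distrib)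
qed

lemma projection_symmetric: "transpose (Om ** transpose Om) = Om ** transpose (Om::real^'k^'n)"
  by (simp add: matrix_transpose_mul)

context
  fixes Om :: "real^'k^'n"
  assumes orth: "transpose Om ** Om = mat 1"
begin

lemma projection_idem: "(Om ** transpose Om) ** (Om ** transpose Om) = Om ** transpose Om"
  by (metis matrix_mul_assoc matrix_mul_rid orth)

lemma transpose_mult_eq_0_iff: "transpose Om *v x = 0 \<longleftrightarrow> (Om ** transpose Om) *v x = 0"
proof
  assume "(Om ** transpose Om) *v x = 0"
  then have "(transpose Om ** Om ** transpose Om) *v x = 0"
    by (metis matrix_mul_assoc matrix_vector_mul_assoc matrix_vector_mult_0_right)
  then show "transpose Om *v x = 0" by (simp add: orth)
qed (simp flip: matrix_vector_mul_assoc)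

lemma kerOT_eq: "kerOT Om = {v. (Om ** transpose Om) *v v = 0}"
  unfolding kerOT_def using transpose_mult_eq_0_iff by blast

lemma reflection_fixes_kernel:
  assumes "transpose Om *v w = 0"
  shows "(mat 1 - 2 *\<^sub>R (Om ** transpose Om)) *v w = w"
  using assms transpose_mult_eq_0_iff by (simp add: reflection_apply)

subsection \<open>Mirror-symmetric losses\<close>

lemma mirror_symmetric_gradient_reflects:
  fixes l0 :: "real^'n \<Rightarrow> real"
  assumes grad: "\<And>w. (l0 has_derivative (\<lambda>h. g w \<bullet> h)) (at w)"
    and mirror: "\<And>w. l0 w = l0 ((mat 1 - 2 *\<^sub>R (Om ** transpose Om)) *v w)"
  shows "g w = (mat 1 - 2 *\<^sub>R (Om ** transpose Om)) *v g ((mat 1 - 2 *\<^sub>R (Om ** transpose Om)) *v w)"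
  using gradient_of_invariant_function[OF grad, of "mat 1 - 2 *\<^sub>R (Om ** transpose Om)" w] mirror
  unfolding reflection_symmetric[OF projection_symmetric] by simp

lemma mirror_symmetric_gradient_in_kernel:
  fixes l0 :: "real^'n \<Rightarrow> real"
  assumes grad: "\<And>w. (l0 has_derivative (\<lambda>h. g w \<bullet> h)) (at w)"
    and mirror: "\<And>w. l0 w = l0 ((mat 1 - 2 *\<^sub>R (Om ** transpose Om)) *v w)"
    and w: "transpose Om *v w = 0"
  shows "transpose Om *v g w = 0"
proof -
  have "g w = (mat 1 - 2 *\<^sub>R (Om ** transpose Om)) *v g w"
    using mirror_symmetric_gradient_reflects[OF grad mirror, of w] reflection_fixes_kernel[OF w]
    by simp
  then have "(Om ** transpose Om) *v g w = 0"
    unfolding reflection_apply by simp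
  then show ?thesis using transpose_mult_eq_0_iff by blast
qed

lemma mirror_symmetric_lgam_gradient_in_kernel:
  fixes l0 :: "real^'n \<Rightarrow> real"
  assumes grad: "\<And>w. (l0 has_derivative (\<lambda>h. g w \<bullet> h)) (at w)"
    and mirror: "\<And>w. l0 w = l0 ((mat 1 - 2 *\<^sub>R (Om ** transpose Om)) *v w)"
    and w: "transpose Om *v w = 0"
    and G: "(lgam l0 \<gamma> has_derivative (\<lambda>h. G \<bullet> h)) (at w)"
  shows "transpose Om *v G = 0"
proof -
  have "G = g w + (2 * \<gamma>) *\<^sub>R w"
    using has_derivative_unique[OF G lgam_has_derivative[where g = g, OF grad]] by (metis vector_eq_rdot)
  with mirror_symmetric_gradient_in_kernel[OF grad mirror w] w show ?thesis
    by (simp add: matrix_vector_right_distrib matrix_vector_mult_scaleR)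
qed

lemma mirror_symmetric_hessian_commutes:
  fixes l0 :: "real^'n \<Rightarrow> real"
  assumes grad: "\<And>w. (l0 has_derivative (\<lambda>h. g w \<bullet> h)) (at w)"
    and hess: "\<And>w. (g has_derivative (\<lambda>h. H w *v h)) (at w)"
    and mirror: "\<And>w. l0 w = l0 ((mat 1 - 2 *\<^sub>R (Om ** transpose Om)) *v w)"
    and w: "transpose Om *v w = 0"
  shows "H w ** (Om ** transpose Om) = (Om ** transpose Om) ** H w"
proof -
  define P where "P = Om ** transpose Om"
  define R where "R = mat 1 - 2 *\<^sub>R P"
  have R_sym: "transpose R = R"
    unfolding R_def P_def by (rule reflection_symmetric[OF projection_symmetric])
  have invariant: "transpose R *v g (R *v x) = g x" for x
    unfolding R_sym unfolding R_def P_def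
    by (rule mirror_symmetric_gradient_reflects[OF grad mirror, symmetric])
  have "H w *v (R *v h) = R *v (H w *v (R *v (R *v h)))" for h
    using hessian_of_invariant_gradient[OF hess invariant, of w "R *v h"]
    unfolding R_sym unfolding R_def P_def reflection_fixes_kernel[OF w] .
  then have "H w *v (R *v h) = R *v (H w *v h)" for h
    unfolding R_def P_def reflection_involutive[OF projection_idem] .
  then have "H w *v (P *v h) = P *v (H w *v h)" for h
    unfolding R_def reflection_apply
    by (simp add: matrix_vector_mult_diff_distrib matrix_vector_mult_scaleR)
  then show ?thesis
    unfolding P_def matrix_eq by (simp flip: matrix_vector_mul_assoc)
qed

lemma mirror_symmetric_hessian_eigenbasis:
  fixes l0 :: "real^'n \<Rightarrow> real"
  assumes grad: "\<And>w. (l0 has_derivative (\<lambda>h. g w \<bullet> h)) (at w)"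
    and hess: "\<And>w. (g has_derivative (\<lambda>h. H w *v h)) (at w)"
    and hess_cont: "continuous_on UNIV H"
    and mirror: "\<And>w. l0 w = l0 ((mat 1 - 2 *\<^sub>R (Om ** transpose Om)) *v w)"
    and w: "(Om ** transpose Om) *v w = 0"
  shows "(\<forall>v\<in>kerOT Om. H w *v v \<in> kerOT Om)
      \<and> (\<forall>v\<in>imOOT Om. H w *v v \<in> imOOT Om)
      \<and> (\<exists>B B1. pairwise orthogonal B \<and> (\<forall>b\<in>B. norm b = 1) \<and> span B = UNIV
            \<and> (\<forall>b\<in>B. \<exists>\<mu>::real. H w *v b = \<mu> *\<^sub>R b)
            \<and> B1 \<subseteq> B \<and> span B1 = kerOT Om \<and> span (B - B1) = imOOT Om)"
proof -
  have commute: "H w ** (Om ** transpose Om) = (Om ** transpose Om) ** H w"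
    using w transpose_mult_eq_0_iff by (intro mirror_symmetric_hessian_commutes[OF grad hess mirror]) simp
  then have HP: "H w *v ((Om ** transpose Om) *v v) = (Om ** transpose Om) *v (H w *v v)" for v
    by (simp add: matrix_vector_mul_assoc)
  have "(Om ** transpose Om) *v (H w *v v) = 0" if "(Om ** transpose Om) *v v = 0" for v
    using HP[of v] that by simp
  then have "\<forall>v\<in>kerOT Om. H w *v v \<in> kerOT Om"
    unfolding kerOT_eq by simp
  moreover have "\<forall>v\<in>imOOT Om. H w *v v \<in> imOOT Om"
    unfolding imOOT_def using HP by auto
  moreover have "\<exists>B B1. pairwise orthogonal B \<and> (\<forall>b\<in>B. norm b = 1) \<and> span B = UNIV
            \<and> (\<forall>b\<in>B. \<exists>\<mu>::real. H w *v b = \<mu> *\<^sub>R b)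
            \<and> B1 \<subseteq> B \<and> span B1 = kerOT Om \<and> span (B - B1) = imOOT Om"
    unfolding kerOT_eq imOOT_def
    by (rule orthonormal_eigenbasis_split_by_projection[OF
          hessian_symmetric[OF grad hess hess_cont] projection_symmetric projection_idem commute])
  ultimately show ?thesis by blast
qed

lemma projection_removal_decreases_lgam:
  fixes l0 :: "real^'n \<Rightarrow> real"
  assumes "transpose Om *v w \<noteq> 0"
  shows "\<exists>\<gamma>0. \<forall>\<gamma>>\<gamma>0. lgam l0 \<gamma> ((mat 1 - Om ** transpose Om) *v w) < lgam l0 \<gamma> w"
proof -
  define p where "p = (Om ** transpose Om) *v w"
  have "(norm p)\<^sup>2 > 0" unfolding p_def using assms transpose_mult_eq_0_iff by simp
  moreover have "(norm w)\<^sup>2 = (norm (w - p))\<^sup>2 + (norm p)\<^sup>2"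
    unfolding p_def by (rule norm_pythagoras_projection[OF projection_symmetric projection_idem])
  ultimately have "lgam l0 \<gamma> (w - p) < lgam l0 \<gamma> w"
    if "\<gamma> > (l0 (w - p) - l0 w) / (norm p)\<^sup>2" for \<gamma>
    using that unfolding lgam_def by (simp add: pos_divide_less_eq algebra_simps)
  then show ?thesis
    unfolding p_def by (auto simp: matrix_vector_mult_diff_rdistrib)
qed

lemma mirror_symmetric_minimizer_in_kernel:
  fixes l0 :: "real^'n \<Rightarrow> real"
  assumes grad: "\<And>w. (l0 has_derivative (\<lambda>h. g w \<bullet> h)) (at w)"
    and hess: "\<And>w. (g has_derivative (\<lambda>h. H w *v h)) (at w)"
    and mirror: "\<And>w. l0 w = l0 ((mat 1 - 2 *\<^sub>R (Om ** transpose Om)) *v w)"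
    and lower: "\<And>x v. lmin * (v \<bullet> v) \<le> (H x *v v) \<bullet> v"
    and \<gamma>: "\<gamma> > - lmin / 2"
    and min: "\<And>u. lgam l0 \<gamma> w \<le> lgam l0 \<gamma> u"
  shows "transpose Om *v w = 0"
proof (rule ccontr)
  assume "transpose Om *v w \<noteq> 0"
  define p where "p = (Om ** transpose Om) *v w"
  define u where "u = w - p"
  have "p \<bullet> p > 0" unfolding p_def using \<open>transpose Om *v w \<noteq> 0\<close> transpose_mult_eq_0_iff by simp
  have norm_w: "(norm w)\<^sup>2 = (norm u)\<^sup>2 + p \<bullet> p"
    using norm_pythagoras_projection[OF projection_symmetric projection_idem, of w]
    unfolding u_def p_def by (simp add: power2_norm_eq_inner)
  \<comment> \<open>Restricted to the line through u in direction p, lgam is strictly convex and even in t.\<close>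
  define k where "k t = l0 (u + t *\<^sub>R p) + \<gamma> * t\<^sup>2 * (p \<bullet> p)" for t
  define k' where "k' t = g (u + t *\<^sub>R p) \<bullet> p + 2 * \<gamma> * t * (p \<bullet> p)" for t
  define k'' where "k'' t = (H (u + t *\<^sub>R p) *v p) \<bullet> p + 2 * \<gamma> * (p \<bullet> p)" for t
  have "(k has_real_derivative k' t) (at t)" for t
    unfolding k_def k'_def
    by (auto intro!: derivative_eq_intros has_real_derivative_along_line[OF grad])
  moreover have "(k' has_real_derivative k'' t) (at t)" for t
    unfolding k'_def k''_def
    by (auto intro!: derivative_eq_intros has_real_derivative_gradient_along_line[OF hess])
  moreover have "k'' t > 0" for t
  proof -
    have "(lmin + 2 * \<gamma>) * (p \<bullet> p) > 0" using \<gamma> \<open>p \<bullet> p > 0\<close> by simp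
    with lower[of p "u + t *\<^sub>R p"] show ?thesis unfolding k''_def by (simp add: algebra_simps)
  qed
  ultimately have "2 * k 0 < k (-1) + k 1"
    using strict_midpoint_convex_if_second_derivative_pos[of k k' k'' "-1" 1] by simp
  moreover have "k (-1) = k 1"
  proof -
    have "u + (-1) *\<^sub>R p = (mat 1 - 2 *\<^sub>R (Om ** transpose Om)) *v w"
      unfolding reflection_apply u_def p_def by (simp add: scaleR_2)
    then show ?thesis unfolding k_def using mirror[of w] by (simp add: u_def)
  qed
  moreover have "k 1 \<le> k 0"
    using min[of u] unfolding k_def lgam_def norm_w by (simp add: u_def algebra_simps)
  ultimately show False by linarith
qed

end

theorem theorem1:
  fixes l0 :: "real^'d \<Rightarrow> real"
    and g :: "real^'d \<Rightarrow> real^'d"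
    and H :: "real^'d \<Rightarrow> real^'d^'d"
    and Om :: "real^'k^'d"
  assumes grad: "\<And>w. (l0 has_derivative (\<lambda>h. g w \<bullet> h)) (at w)"
    and hess: "\<And>w. (g has_derivative (\<lambda>h. H w *v h)) (at w)"
    and hess_cont: "continuous_on UNIV H"
    and orth: "transpose Om ** Om = mat 1"
    and mirror: "\<And>w. l0 w = l0 ((mat 1 - 2 *\<^sub>R (Om ** transpose Om)) *v w)"
  shows
    "(\<forall>\<gamma> w G. transpose Om *v w = 0 \<longrightarrow>
        (lgam l0 \<gamma> has_derivative (\<lambda>h. G \<bullet> h)) (at w) \<longrightarrow>
        transpose Om *v G = 0)
   \<and> (\<forall>w. (Om ** transpose Om) *v w = 0 \<longrightarrow>
        (\<forall>v\<in>kerOT Om. H w *v v \<in> kerOT Om)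
      \<and> (\<forall>v\<in>imOOT Om. H w *v v \<in> imOOT Om)
      \<and> (\<exists>B B1. pairwise orthogonal B \<and> (\<forall>b\<in>B. norm b = 1) \<and> span B = UNIV
            \<and> (\<forall>b\<in>B. \<exists>\<mu>::real. H w *v b = \<mu> *\<^sub>R b)
            \<and> B1 \<subseteq> B \<and> span B1 = kerOT Om \<and> span (B - B1) = imOOT Om))
   \<and> (\<forall>w. transpose Om *v w \<noteq> 0 \<longrightarrow>
        (\<exists>\<gamma>0. \<forall>\<gamma>>\<gamma>0.
           lgam l0 \<gamma> ((mat 1 - Om ** transpose Om) *v w) < lgam l0 \<gamma> w))
   \<and> ((\<exists>lmin::real. \<forall>w v \<mu>. v \<noteq> 0 \<and> H w *v v = \<mu> *\<^sub>R v \<longrightarrow> lmin \<le> \<mu>) \<longrightarrow>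
        (\<exists>\<gamma>1. \<forall>\<gamma>>\<gamma>1. \<forall>w. (\<forall>u. lgam l0 \<gamma> w \<le> lgam l0 \<gamma> u) \<longrightarrow> transpose Om *v w = 0))"
proof (intro conjI impI allI)
  show "transpose Om *v G = 0"
    if "transpose Om *v w = 0" "(lgam l0 \<gamma> has_derivative (\<lambda>h. G \<bullet> h)) (at w)" for \<gamma> w G
    using mirror_symmetric_lgam_gradient_in_kernel[OF orth grad mirror that] .
  show "\<exists>\<gamma>0. \<forall>\<gamma>>\<gamma>0. lgam l0 \<gamma> ((mat 1 - Om ** transpose Om) *v w) < lgam l0 \<gamma> w"
    if "transpose Om *v w \<noteq> 0" for w
    using projection_removal_decreases_lgam[OF orth that] .
  show "\<exists>\<gamma>1. \<forall>\<gamma>>\<gamma>1. \<forall>w. (\<forall>u. lgam l0 \<gamma> w \<le> lgam l0 \<gamma> u) \<longrightarrow> transpose Om *v w = 0"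
    if "\<exists>lmin::real. \<forall>w v \<mu>. v \<noteq> 0 \<and> H w *v v = \<mu> *\<^sub>R v \<longrightarrow> lmin \<le> \<mu>"
  proof -
    from that obtain lmin :: real where "\<And>w v \<mu>. v \<noteq> 0 \<Longrightarrow> H w *v v = \<mu> *\<^sub>R v \<Longrightarrow> lmin \<le> \<mu>"
      by blast
    then have "lmin * (v \<bullet> v) \<le> (H x *v v) \<bullet> v" for x v
      by (rule eigenvalue_lower_bound_imp_quadratic_form_lower_bound[OF
            hessian_symmetric[OF grad hess hess_cont]])
    with mirror_symmetric_minimizer_in_kernel[OF orth grad hess mirror] show ?thesis
      by (intro exI[of _ "- lmin / 2"]) blast
  qed
qed (use mirror_symmetric_hessian_eigenbasis[OF orth grad hess hess_cont mirror] in blast)+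

end
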